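(* Let $R$ be an associative ring (not necessarily unital). For $i=1,2$ let $a_i,b_i,c_i\in R$ and suppose that $a_i$ is annihilator $(b_i,c_i)$-invertible with annihilator $(b_i,c_i)$-inverse $x_i$. If at least one of the following holds: (i) $x_1a_1=a_1x_1$ and $c_1=c_2$; (ii) $x_2a_2=a_2x_2$ and $b_1=b_2$; (iii) $x_1a_1=a_2x_2$; then $a_1a_2$ is annihilator $(b_2,c_1)$-invertible and its annihilator $(b_2,c_1)$-inverse is $x_2x_1$.
   Context: For $u\in R$ write ${}^{\circ}u=\{r\in R: ru=0\}$ and $u^{\circ}=\{r\in R: ur=0\}$. For $a,b,c\in R$, an element $x\in R$ is an annihilator $(b,c)$-inverse of $a$ if $xax=x$, $xab=b$, $cax=c$, ${}^{\circ}b\subseteq{}^{\circ}x$, and $c^{\circ}\subseteq x^{\circ}$; such $x$ is unique when it exists, and $a$ is then called annihilator $(b,c)$-invertible. *)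

theory Defs
  imports Main
begin

text \<open>The type class \<open>ring\<close> is that of associative rings, not necessarily unital.\<close>

definition left_annihilator :: "'a::ring \<Rightarrow> 'a set" where
  "left_annihilator u = {r. r * u = 0}"

definition right_annihilator :: "'a::ring \<Rightarrow> 'a set" where
  "right_annihilator u = {r. u * r = 0}"

definition is_annihilator_inverse :: "'a::ring \<Rightarrow> 'a \<Rightarrow> 'a \<Rightarrow> 'a \<Rightarrow> bool" where
  "is_annihilator_inverse a b c x \<longleftrightarrow>
     x * a * x = x \<and> x * a * b = b \<and> c * a * x = c \<and>
     left_annihilator b \<subseteq> left_annihilator x \<and>
     right_annihilator c \<subseteq> right_annihilator x"

definition annihilator_invertible :: "'a::ring \<Rightarrow> 'a \<Rightarrow> 'a \<Rightarrow> bool" where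
  "annihilator_invertible a b c \<longleftrightarrow> (\<exists>x. is_annihilator_inverse a b c x)"

text \<open>Uniqueness justifies speaking of \<^emph>\<open>the\<close> annihilator \<open>(b,c)\<close>-inverse of \<open>a\<close>.\<close>

lemma is_annihilator_inverse_unique:
  assumes x: "is_annihilator_inverse a b c x" and y: "is_annihilator_inverse a b c y"
  shows "x = y"
proof -
  have "a * y - a * x \<in> right_annihilator c"
    using x y by (simp add: is_annihilator_inverse_def right_annihilator_def
        right_diff_distrib mult.assoc)
  then have "x * (a * y - a * x) = 0"
    using x by (auto simp: is_annihilator_inverse_def right_annihilator_def)
  then have 1: "x * a * y = x"
    using x by (simp add: is_annihilator_inverse_def right_diff_distrib mult.assoc)
  have "y * a - x * a \<in> left_annihilator b"
    using x y by (simp add: is_annihilator_inverse_def left_annihilator_def left_diff_distrib)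
  then have "(y * a - x * a) * y = 0"
    using y by (auto simp: is_annihilator_inverse_def left_annihilator_def)
  then have "x * a * y = y"
    using y by (simp add: is_annihilator_inverse_def left_diff_distrib)
  with 1 show ?thesis by simp
qed

end

theory Submission
  imports Defs
begin

text \<open>
  If \<open>x\<close> is an annihilator \<open>(b, c)\<close>-inverse of \<open>a\<close>, then \<open>x\<close> has the left annihilator of \<open>b\<close>
  and the right annihilator of \<open>c\<close>.  Hence, in identities, \<open>b\<close> may be exchanged for \<open>x\<close> as a
  right factor and \<open>c\<close> for \<open>x\<close> as a left factor.  For the candidate \<open>x\<^sub>2 * x\<^sub>1\<close> this reduces every
  requirement to the two identities
  \<open>x\<^sub>2 * (x\<^sub>1 * a\<^sub>1) * (a\<^sub>2 * x\<^sub>2) = x\<^sub>2\<close> and \<open>(x\<^sub>1 * a\<^sub>1) * (a\<^sub>2 * x\<^sub>2) * x\<^sub>1 = x\<^sub>1\<close>,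
  in which \<open>b\<close> and \<open>c\<close> no longer occur (lemma \<open>is_annihilator_inverse_mult\<close>).

  Both identities say that the product of the idempotents \<open>x\<^sub>1 * a\<^sub>1\<close> and \<open>a\<^sub>2 * x\<^sub>2\<close> acts
  trivially.  If these idempotents coincide, their common value fixes \<open>x\<^sub>2\<close> from the
  right and \<open>x\<^sub>1\<close> from the left.  If \<open>c\<^sub>1 = c\<^sub>2\<close>, then \<open>x\<^sub>1\<close> and
  \<open>x\<^sub>2\<close> have the same right annihilator, so that \<open>x\<^sub>1 * (a\<^sub>1 * x\<^sub>1) = x\<^sub>1\<close> and
  \<open>x\<^sub>2 * (a\<^sub>2 * x\<^sub>2) = x\<^sub>2\<close> carry over to products beginning with the other element; commutation of
  \<open>x\<^sub>1\<close> and \<open>a\<^sub>1\<close> puts the idempotents into the required position.  The case \<open>b\<^sub>1 = b\<^sub>2\<close> is the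
  mirror image, with left annihilators.
\<close>

lemma left_annihilator_cancel:
  fixes s t u v :: "'a::ring"
  assumes "left_annihilator u \<subseteq> left_annihilator v" and "s * u = t * u"
  shows "s * v = t * v"
proof -
  have "s - t \<in> left_annihilator u"
    using assms(2) by (simp add: left_annihilator_def left_diff_distrib)
  then have "s - t \<in> left_annihilator v"
    using assms(1) by blast
  then show ?thesis
    by (simp add: left_annihilator_def left_diff_distrib)
qed

lemma right_annihilator_cancel:
  fixes s t u v :: "'a::ring"
  assumes "right_annihilator u \<subseteq> right_annihilator v" and "u * s = u * t"
  shows "v * s = v * t"
proof -
  have "s - t \<in> right_annihilator u"
    using assms(2) by (simp add: right_annihilator_def right_diff_distrib)
  then have "s - t \<in> right_annihilator v"
    using assms(1) by blast
  then show ?thesis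
    by (simp add: right_annihilator_def right_diff_distrib)
qed

text \<open>
  Since \<open>b = x * a * b\<close> and \<open>c = c * a * x\<close> are multiples of \<open>x\<close>, the two inclusions of
  annihilators in the definition are equalities.
\<close>

lemma left_annihilator_inverse_eq:
  assumes "is_annihilator_inverse a b c x"
  shows "left_annihilator x = left_annihilator b"
proof
  have "x * (a * b) = b"
    using assms by (simp add: is_annihilator_inverse_def mult.assoc)
  then have "r * b = 0" if "r * x = 0" for r
    using that by (metis mult.assoc mult_zero_left)
  then show "left_annihilator x \<subseteq> left_annihilator b"
    by (auto simp: left_annihilator_def)
  show "left_annihilator b \<subseteq> left_annihilator x"
    using assms by (simp add: is_annihilator_inverse_def)
qed

lemma right_annihilator_inverse_eq:
  assumes "is_annihilator_inverse a b c x"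
  shows "right_annihilator x = right_annihilator c"
proof
  have "c * a * x = c"
    using assms by (simp add: is_annihilator_inverse_def)
  then have "c * r = 0" if "x * r = 0" for r
    using that by (metis mult.assoc mult_zero_right)
  then show "right_annihilator x \<subseteq> right_annihilator c"
    by (auto simp: right_annihilator_def)
  show "right_annihilator c \<subseteq> right_annihilator x"
    using assms by (simp add: is_annihilator_inverse_def)
qed

text \<open>
  The two hypotheses on products are the requirements \<open>x\<^sub>2 * x\<^sub>1 * (a\<^sub>1 * a\<^sub>2) * b\<^sub>2 = b\<^sub>2\<close> and
  \<open>c\<^sub>1 * (a\<^sub>1 * a\<^sub>2) * (x\<^sub>2 * x\<^sub>1) = c\<^sub>1\<close> after the exchange of \<open>b\<^sub>2\<close> for \<open>x\<^sub>2\<close> and of \<open>c\<^sub>1\<close> for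
  \<open>x\<^sub>1\<close>.
\<close>

lemma is_annihilator_inverse_mult:
  fixes a\<^sub>1 b\<^sub>1 c\<^sub>1 x\<^sub>1 a\<^sub>2 b\<^sub>2 c\<^sub>2 x\<^sub>2 :: "'a::ring"
  assumes x1: "is_annihilator_inverse a\<^sub>1 b\<^sub>1 c\<^sub>1 x\<^sub>1"
    and x2: "is_annihilator_inverse a\<^sub>2 b\<^sub>2 c\<^sub>2 x\<^sub>2"
    and A: "x\<^sub>2 * (x\<^sub>1 * a\<^sub>1) * (a\<^sub>2 * x\<^sub>2) = x\<^sub>2"
    and B: "(x\<^sub>1 * a\<^sub>1) * (a\<^sub>2 * x\<^sub>2) * x\<^sub>1 = x\<^sub>1"
  shows "is_annihilator_inverse (a\<^sub>1 * a\<^sub>2) b\<^sub>2 c\<^sub>1 (x\<^sub>2 * x\<^sub>1)"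
proof -
  have "x\<^sub>2 * x\<^sub>1 * (a\<^sub>1 * a\<^sub>2) * (x\<^sub>2 * x\<^sub>1) = x\<^sub>2 * (x\<^sub>1 * a\<^sub>1) * (a\<^sub>2 * x\<^sub>2) * x\<^sub>1"
    by (simp only: mult.assoc)
  also have "\<dots> = x\<^sub>2 * x\<^sub>1"
    by (simp only: A)
  finally have outer: "x\<^sub>2 * x\<^sub>1 * (a\<^sub>1 * a\<^sub>2) * (x\<^sub>2 * x\<^sub>1) = x\<^sub>2 * x\<^sub>1" .
  \<comment> \<open>The ring may lack a unit, so the identities to be transferred need a factor on both sides;
    \<open>x\<^sub>2 * a\<^sub>2\<close> and \<open>a\<^sub>1 * x\<^sub>1\<close> serve as local units.\<close>
  have "x\<^sub>2 * x\<^sub>1 * (a\<^sub>1 * a\<^sub>2) * x\<^sub>2 = x\<^sub>2 * a\<^sub>2 * x\<^sub>2"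
    using A x2 by (simp add: is_annihilator_inverse_def mult.assoc)
  then have "x\<^sub>2 * x\<^sub>1 * (a\<^sub>1 * a\<^sub>2) * b\<^sub>2 = x\<^sub>2 * a\<^sub>2 * b\<^sub>2"
    by (rule left_annihilator_cancel[rotated]) (simp add: left_annihilator_inverse_eq[OF x2])
  then have fix_b: "x\<^sub>2 * x\<^sub>1 * (a\<^sub>1 * a\<^sub>2) * b\<^sub>2 = b\<^sub>2"
    using x2 by (simp add: is_annihilator_inverse_def)
  have "x\<^sub>1 * (a\<^sub>1 * a\<^sub>2 * (x\<^sub>2 * x\<^sub>1)) = x\<^sub>1 * (a\<^sub>1 * x\<^sub>1)"
    using B x1 by (simp add: is_annihilator_inverse_def mult.assoc)
  then have "c\<^sub>1 * (a\<^sub>1 * a\<^sub>2 * (x\<^sub>2 * x\<^sub>1)) = c\<^sub>1 * (a\<^sub>1 * x\<^sub>1)"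
    by (rule right_annihilator_cancel[rotated]) (simp add: right_annihilator_inverse_eq[OF x1])
  then have fix_c: "c\<^sub>1 * (a\<^sub>1 * a\<^sub>2) * (x\<^sub>2 * x\<^sub>1) = c\<^sub>1"
    using x1 by (simp add: is_annihilator_inverse_def mult.assoc)
  have "left_annihilator x\<^sub>2 \<subseteq> left_annihilator (x\<^sub>2 * x\<^sub>1)"
    by (auto simp: left_annihilator_def simp flip: mult.assoc)
  moreover have "right_annihilator x\<^sub>1 \<subseteq> right_annihilator (x\<^sub>2 * x\<^sub>1)"
    by (auto simp: right_annihilator_def mult.assoc)
  ultimately show ?thesis
    using outer fix_b fix_c left_annihilator_inverse_eq[OF x2] right_annihilator_inverse_eq[OF x1]
    by (simp add: is_annihilator_inverse_def)
qed

theorem theorem4p5: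
  fixes a\<^sub>1 b\<^sub>1 c\<^sub>1 x\<^sub>1 a\<^sub>2 b\<^sub>2 c\<^sub>2 x\<^sub>2 :: "'a::ring"
  assumes "is_annihilator_inverse a\<^sub>1 b\<^sub>1 c\<^sub>1 x\<^sub>1"
    and "is_annihilator_inverse a\<^sub>2 b\<^sub>2 c\<^sub>2 x\<^sub>2"
    and "(x\<^sub>1 * a\<^sub>1 = a\<^sub>1 * x\<^sub>1 \<and> c\<^sub>1 = c\<^sub>2) \<or>
         (x\<^sub>2 * a\<^sub>2 = a\<^sub>2 * x\<^sub>2 \<and> b\<^sub>1 = b\<^sub>2) \<or>
         x\<^sub>1 * a\<^sub>1 = a\<^sub>2 * x\<^sub>2"
  shows "annihilator_invertible (a\<^sub>1 * a\<^sub>2) b\<^sub>2 c\<^sub>1 \<and>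
         is_annihilator_inverse (a\<^sub>1 * a\<^sub>2) b\<^sub>2 c\<^sub>1 (x\<^sub>2 * x\<^sub>1)"
proof -
  have x1: "x\<^sub>1 * a\<^sub>1 * x\<^sub>1 = x\<^sub>1" and x2: "x\<^sub>2 * a\<^sub>2 * x\<^sub>2 = x\<^sub>2"
    using assms(1,2) by (simp_all add: is_annihilator_inverse_def)
  have "x\<^sub>2 * (x\<^sub>1 * a\<^sub>1) * (a\<^sub>2 * x\<^sub>2) = x\<^sub>2 \<and> (x\<^sub>1 * a\<^sub>1) * (a\<^sub>2 * x\<^sub>2) * x\<^sub>1 = x\<^sub>1"
    using assms(3)
  proof (elim disjE conjE)
    assume comm: "x\<^sub>1 * a\<^sub>1 = a\<^sub>1 * x\<^sub>1" and c: "c\<^sub>1 = c\<^sub>2"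
    have ann: "right_annihilator x\<^sub>1 = right_annihilator x\<^sub>2"
      using right_annihilator_inverse_eq[OF assms(1)] right_annihilator_inverse_eq[OF assms(2)] c
      by simp
    have "x\<^sub>1 * (a\<^sub>1 * x\<^sub>1 * (a\<^sub>2 * x\<^sub>2)) = x\<^sub>1 * (a\<^sub>2 * x\<^sub>2)"
      using x1 by (metis mult.assoc)
    then have A: "x\<^sub>2 * (a\<^sub>1 * x\<^sub>1 * (a\<^sub>2 * x\<^sub>2)) = x\<^sub>2 * (a\<^sub>2 * x\<^sub>2)"
      by (rule right_annihilator_cancel[rotated]) (simp add: ann)
    have "x\<^sub>2 * (a\<^sub>2 * x\<^sub>2 * x\<^sub>1) = x\<^sub>2 * x\<^sub>1"
      using x2 by (metis mult.assoc)
    then have B: "x\<^sub>1 * (a\<^sub>2 * x\<^sub>2 * x\<^sub>1) = x\<^sub>1 * x\<^sub>1"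
      by (rule right_annihilator_cancel[rotated]) (simp add: ann)
    have "x\<^sub>2 * (x\<^sub>1 * a\<^sub>1) * (a\<^sub>2 * x\<^sub>2) = x\<^sub>2"
      using A x2 comm by (simp add: mult.assoc)
    moreover have "(x\<^sub>1 * a\<^sub>1) * (a\<^sub>2 * x\<^sub>2) * x\<^sub>1 = a\<^sub>1 * (x\<^sub>1 * x\<^sub>1)"
      using B comm by (simp add: mult.assoc)
    moreover have "a\<^sub>1 * (x\<^sub>1 * x\<^sub>1) = x\<^sub>1"
      using x1 comm by (simp flip: mult.assoc)
    ultimately show ?thesis by simp
  next
    assume comm: "x\<^sub>2 * a\<^sub>2 = a\<^sub>2 * x\<^sub>2" and b: "b\<^sub>1 = b\<^sub>2"
    have ann: "left_annihilator x\<^sub>1 = left_annihilator x\<^sub>2"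
      using left_annihilator_inverse_eq[OF assms(1)] left_annihilator_inverse_eq[OF assms(2)] b
      by simp
    have "x\<^sub>2 * (x\<^sub>1 * a\<^sub>1) * x\<^sub>1 = x\<^sub>2 * x\<^sub>1"
      using x1 by (simp add: mult.assoc)
    then have A: "x\<^sub>2 * (x\<^sub>1 * a\<^sub>1) * x\<^sub>2 = x\<^sub>2 * x\<^sub>2"
      by (rule left_annihilator_cancel[rotated]) (simp add: ann)
    have "x\<^sub>1 * a\<^sub>1 * (x\<^sub>2 * a\<^sub>2) * x\<^sub>2 = x\<^sub>1 * a\<^sub>1 * x\<^sub>2"
      using x2 by (simp add: mult.assoc)
    then have B: "x\<^sub>1 * a\<^sub>1 * (x\<^sub>2 * a\<^sub>2) * x\<^sub>1 = x\<^sub>1 * a\<^sub>1 * x\<^sub>1"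
      by (rule left_annihilator_cancel[rotated]) (simp add: ann)
    have "x\<^sub>2 * (x\<^sub>1 * a\<^sub>1) * (a\<^sub>2 * x\<^sub>2) = x\<^sub>2 * (x\<^sub>1 * a\<^sub>1) * x\<^sub>2 * a\<^sub>2"
      using comm by (simp add: mult.assoc)
    also have "\<dots> = x\<^sub>2 * (x\<^sub>2 * a\<^sub>2)"
      using A by (simp add: mult.assoc)
    also have "\<dots> = x\<^sub>2"
      by (metis comm mult.assoc x2)
    finally have "x\<^sub>2 * (x\<^sub>1 * a\<^sub>1) * (a\<^sub>2 * x\<^sub>2) = x\<^sub>2" .
    moreover have "(x\<^sub>1 * a\<^sub>1) * (a\<^sub>2 * x\<^sub>2) * x\<^sub>1 = x\<^sub>1"
      using B x1 comm by simp
    ultimately show ?thesis by simp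
  next
    assume eq: "x\<^sub>1 * a\<^sub>1 = a\<^sub>2 * x\<^sub>2"
    have fixed: "x\<^sub>2 * (a\<^sub>2 * x\<^sub>2) = x\<^sub>2"
      using x2 by (simp add: mult.assoc)
    have "x\<^sub>2 * (x\<^sub>1 * a\<^sub>1) * (a\<^sub>2 * x\<^sub>2) = x\<^sub>2"
      by (simp only: eq fixed)
    moreover have "(x\<^sub>1 * a\<^sub>1) * (a\<^sub>2 * x\<^sub>2) * x\<^sub>1 = (x\<^sub>1 * a\<^sub>1) * (x\<^sub>1 * a\<^sub>1 * x\<^sub>1)"
      by (simp only: eq mult.assoc)
    ultimately show ?thesis
      by (simp only: x1 simp_thms)
  qed
  then have "is_annihilator_inverse (a\<^sub>1 * a\<^sub>2) b\<^sub>2 c\<^sub>1 (x\<^sub>2 * x\<^sub>1)"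
    using is_annihilator_inverse_mult[OF assms(1,2)] by blast
  then show ?thesis
    by (auto simp: annihilator_invertible_def)
qed

end
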